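(* For the star $K_{1,n}$ on $n+1$ vertices, $\operatorname{ept}(K_{1,n})=\Theta(\log n)$ as $n\to\infty$.
   Context: Probabilistic zero forcing on a graph $G$: vertices are colored blue or white. The process proceeds in rounds $1,2,3,\dots$. In a round, let $B$ be the set of blue vertices at the start of the round; each blue vertex $u$ fires at each of its white neighbors $w$, and each such fire succeeds independently with probability $|N[u]\cap B|/\deg u$, where $N[u]$ is the closed neighborhood of $u$. At the end of the round, every white vertex at which at least one fire succeeded becomes blue. For a connected graph $G$ and nonempty $Z\subseteq V(G)$, $\mathrm{pt}_{\rm pzf}(G,Z)$ is the random variable equal to the number of the round in which the last white vertex turns blue when starting with exactly $Z$ blue; $\operatorname{ept}(G,Z)=\mathbf{E}[\mathrm{pt}_{\rm pzf}(G,Z)]$ and $\operatorname{ept}(G)=\min_{v\in V(G)}\operatorname{ept}(G,\{v\})$. *)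

theory Defs
  imports "HOL-Probability.Probability" "HOL-Library.Landau_Symbols" "Graph_Theory.Graph_Theory"
begin

text \<open>A finite simple graph is a digraph satisfying the locale \<^locale>\<open>graph\<close> (finite, symmetric, no
  loops, no parallel arcs); there \<^const>\<open>out_degree\<close> is the usual degree.\<close>

definition closed_nbhd :: "('a, 'b) pre_digraph \<Rightarrow> 'a \<Rightarrow> 'a set" where
  "closed_nbhd G u = insert u {w. u \<rightarrow>\<^bsub>G\<^esub> w}"

definition fire_prob :: "('a, 'b) pre_digraph \<Rightarrow> 'a set \<Rightarrow> 'a \<Rightarrow> real" where
  "fire_prob G B u = real (card (closed_nbhd G u \<inter> B)) / real (out_degree G u)"

text \<open>The randomness of the process: independent variables, uniform on the unit interval, one for
  each potential fire. The value at \<open>(k, u, w)\<close> decides the fire from \<open>u\<close> at \<open>w\<close> in round \<open>k + 1\<close>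
  (so rounds are numbered from 1).\<close>

definition fire_space :: "(nat \<times> 'a \<times> 'a \<Rightarrow> real) measure" where
  "fire_space = (\<Pi>\<^sub>M i\<in>UNIV. uniform_measure lborel {0..1})"

text \<open>\<open>blue G Z \<omega> k\<close> is the set of blue vertices after \<open>k\<close> rounds. It depends only on the coordinates
  of \<open>\<omega>\<close> belonging to the first \<open>k\<close> rounds. So, conditionally on these rounds, the fires of the
  next one are independent and each succeeds with probability \<open>fire_prob G B u\<close>, where \<open>B\<close> is the
  current blue set; this number is at most 1 because \<open>u\<close> has a white neighbour \<open>w\<close>.\<close>

primrec blue :: "('a, 'b) pre_digraph \<Rightarrow> 'a set \<Rightarrow> (nat \<times> 'a \<times> 'a \<Rightarrow> real) \<Rightarrow> nat \<Rightarrow> 'a set" where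
  "blue G Z \<omega> 0 = Z"
| "blue G Z \<omega> (Suc k) = blue G Z \<omega> k \<union>
     {w. w \<notin> blue G Z \<omega> k \<and>
         (\<exists>u \<in> blue G Z \<omega> k. u \<rightarrow>\<^bsub>G\<^esub> w \<and> \<omega> (k, u, w) \<le> fire_prob G (blue G Z \<omega> k) u)}"

definition pt_pzf :: "('a, 'b) pre_digraph \<Rightarrow> 'a set \<Rightarrow> (nat \<times> 'a \<times> 'a \<Rightarrow> real) \<Rightarrow> enat" where
  "pt_pzf G Z \<omega> =
     (if \<exists>k. blue G Z \<omega> k = verts G then enat (LEAST k. blue G Z \<omega> k = verts G) else \<infinity>)"

text \<open>Expectations are taken in \<^typ>\<open>ennreal\<close>. As \<^const>\<open>enn2real\<close> sends infinity to 0, a bound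
  \<open>(\<lambda>n. enn2real (ept (G n))) \<in> \<Theta>(f)\<close> with \<open>f\<close> eventually nonzero also implies that \<open>ept (G n)\<close> is
  eventually finite.\<close>

definition ept_from :: "('a, 'b) pre_digraph \<Rightarrow> 'a set \<Rightarrow> ennreal" where
  "ept_from G Z = (\<integral>\<^sup>+ \<omega>. ennreal_of_enat (pt_pzf G Z \<omega>) \<partial>fire_space)"

definition ept :: "('a, 'b) pre_digraph \<Rightarrow> ennreal" where
  "ept G = Min ((\<lambda>v. ept_from G {v}) ` verts G)"

text \<open>The stars \<open>K\<^bsub>1,n\<^esub>\<close> exist over \<^typ>\<open>nat\<close>, with centre \<open>0\<close> and leaves \<open>1, ..., n\<close>.\<close>

lemma star_exists:
  "K\<^bsub>1,n\<^esub> (with_proj \<lparr>pverts = {0..n}, parcs = {0} \<times> {1..n} \<union> {1..n} \<times> {0}\<rparr>)"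
  unfolding complete_bipartite_digraph_pair_def
  by (intro conjI exI[where x = "{0::nat}"] exI[where x = "{1..n}"]) auto

end

theory Submission
  imports Defs
begin

text \<open>Conditionally on the current blue set \<open>S\<close>, the next round uses fresh randomness, so a one-step
  estimate of \<open>E f(next) \<le> f(S) + c\<close> for \<open>S \<noteq> V\<close> bounds \<open>E f\<close> after \<open>N\<close> rounds by
  \<open>f(Z) + c (P(T > 0) + ... + P(T > N - 1))\<close>, where the sum tends to the expected time \<open>E T\<close>. With
  \<open>f = ln |S|\<close> and \<open>c = 1\<close> (a round at most doubles the number of blue vertices on average), letting
  \<open>N\<close> tend to infinity gives \<open>ln (n + 1) \<le> E T\<close>. For the upper bound, started from the centre, let
  \<open>b = |S|\<close> and let \<open>W = n + 1 - b\<close> be the number of white leaves, each of which turns blue with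
  probability \<open>b / n\<close>. The potential \<open>ln (W + 1) - ln b\<close> decreases by at least \<open>1/4\<close> per round on
  average: its second term measures the growth of the blue set while this is small, the first one
  the decay of the white set afterwards. This gives \<open>E T \<le> 8 ln (n + 1)\<close>.\<close>

section \<open>The product space of the fires and the independence of its coordinates\<close>

lemma prob_space_fire: "prob_space (fire_space :: (nat \<times> 'a \<times> 'a \<Rightarrow> real) measure)"
  unfolding fire_space_def by (intro prob_space_PiM prob_space_uniform_measure) auto

interpretation fire: prob_space "fire_space :: (nat \<times> 'a \<times> 'a \<Rightarrow> real) measure"
  by (rule prob_space_fire)

lemma sets_fire_space: "sets fire_space = sets (Pi\<^sub>M UNIV (\<lambda>_. borel))"
  unfolding fire_space_def by (intro sets_PiM_cong) auto

lemma space_fire_space [simp]: "space fire_space = UNIV"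
  by (auto simp: fire_space_def space_PiM)

lemma prob_fire_UNIV [simp]: "fire.prob UNIV = 1"
  using fire.prob_space by simp

lemma measurable_fire_coordinate [measurable]: "(\<lambda>\<omega>. \<omega> i) \<in> borel_measurable fire_space"
  by (simp add: measurable_cong_sets[OF sets_fire_space refl])

lemma prob_fire_le:
  assumes "finite J" "\<And>i. i \<in> J \<Longrightarrow> 0 \<le> a i" "\<And>i. i \<in> J \<Longrightarrow> a i \<le> 1"
  shows "fire.prob {\<omega>. \<forall>i\<in>J. \<omega> i \<le> a i} = (\<Prod>i\<in>J. a i)"
proof -
  interpret product_prob_space "\<lambda>_. uniform_measure lborel {0..1::real}" UNIV
    by (intro product_prob_spaceI prob_space_uniform_measure) auto
  have "emeasure fire_space {\<omega>. \<forall>i\<in>J. \<omega> i \<le> a i} =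
      emeasure fire_space {\<omega> \<in> space fire_space. \<forall>i\<in>J. \<omega> i \<in> {..a i}}"
    by simp
  also have "\<dots> = (\<Prod>i\<in>J. emeasure (uniform_measure lborel {0..1}) {..a i})"
    unfolding fire_space_def using assms by (intro emeasure_PiM_Collect) auto
  also have "\<dots> = (\<Prod>i\<in>J. ennreal (a i))"
  proof (intro prod.cong refl)
    fix i assume "i \<in> J"
    then have "{0..1} \<inter> {..a i} = {0..a i}" "0 \<le> a i" using assms by auto
    then show "emeasure (uniform_measure lborel {0..1}) {..a i} = ennreal (a i)"
      by (simp add: divide_ennreal_def)
  qed
  finally show ?thesis
    using assms by (simp add: measure_def prod_ennreal prod_nonneg)
qed

text \<open>Independence amounts to the joint law being the product of the marginal laws. The joint
  law is \<open>fire_space\<close> itself, as restriction to \<open>UNIV\<close> is the identity, so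
  only the marginals have to be identified as uniform.\<close>

lemma indep_vars_fire:
  "fire.indep_vars (\<lambda>_. borel) (\<lambda>i \<omega>. \<omega> i) (UNIV :: (nat \<times> 'a \<times> 'a) set)"
proof (subst fire.indep_vars_iff_distr_eq_PiM)
  let ?F = "fire_space :: (nat \<times> 'a \<times> 'a \<Rightarrow> real) measure"
  have "distr ?F (Pi\<^sub>M UNIV (\<lambda>_. borel)) (\<lambda>x. \<lambda>i\<in>UNIV. x i) = ?F"
    by (simp add: restrict_UNIV distr_id2 sets_fire_space)
  also have "\<dots> = Pi\<^sub>M UNIV (\<lambda>i. distr ?F borel (\<lambda>\<omega>. \<omega> i))"
  proof -
    have "distr fire_space borel (\<lambda>\<omega>. \<omega> i) = uniform_measure lborel {0..1}" for i :: "nat \<times> 'a \<times> 'a"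
    proof -
      \<comment> \<open>Only the sigma-algebra of the target matters here; it is replaced by that of
        the factor to fit \<open>distr_PiM_component\<close>.\<close>
      have "distr fire_space borel (\<lambda>\<omega>. \<omega> i) = distr fire_space (uniform_measure lborel {0..1}) (\<lambda>\<omega>. \<omega> i)"
        by (intro distr_cong) auto
      also have "\<dots> = uniform_measure lborel {0..1}"
        unfolding fire_space_def
        by (intro distr_PiM_component prob_space_uniform_measure) auto
      finally show ?thesis .
    qed
    then show ?thesis unfolding fire_space_def by simp
  qed
  finally show "distr ?F (Pi\<^sub>M UNIV (\<lambda>_. borel)) (\<lambda>x. \<lambda>i\<in>UNIV. x i) =
    Pi\<^sub>M UNIV (\<lambda>i. distr ?F borel (\<lambda>\<omega>. \<omega> i))" .
qed auto

section \<open>A single round: measurability and independence of the past\<close>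

text \<open>One step of \<open>blue\<close> with the current set frozen to a deterministic
  \<open>S\<close>. It then reads only coordinates of round \<open>k + 1\<close>, whereas
  \<open>blue G Z \<omega> k\<close> reads only earlier ones.\<close>

definition next_blue :: "('a, 'b) pre_digraph \<Rightarrow> nat \<Rightarrow> 'a set \<Rightarrow> (nat \<times> 'a \<times> 'a \<Rightarrow> real) \<Rightarrow> 'a set" where
  "next_blue G k S \<omega> = S \<union> {w. w \<notin> S \<and> (\<exists>u \<in> S. u \<rightarrow>\<^bsub>G\<^esub> w \<and> \<omega> (k, u, w) \<le> fire_prob G S u)}"

lemma blue_Suc: "blue G Z \<omega> (Suc k) = next_blue G k (blue G Z \<omega> k) \<omega>"
  by (simp add: next_blue_def)

lemma subset_next_blue: "S \<subseteq> next_blue G k S \<omega>"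
  by (auto simp: next_blue_def)

text \<open>Expresses dependence on few coordinates as invariance under \<open>restrict\<close>, the
  form in which independence of disjoint blocks of coordinates is applied below.\<close>

lemma next_blue_restrict:
  "{k} \<times> UNIV \<subseteq> J \<Longrightarrow> next_blue G k S (restrict \<omega> J) = next_blue G k S \<omega>"
  unfolding next_blue_def by (rule arg_cong[where f="\<lambda>X. S \<union> X"]) (auto simp: subset_iff)

lemma blue_restrict:
  "{..<k} \<times> UNIV \<subseteq> J \<Longrightarrow> blue G Z (restrict \<omega> J) k = blue G Z \<omega> k"
proof (induction k)
  case (Suc k)
  then have "{..<k} \<times> UNIV \<subseteq> J" "{k} \<times> UNIV \<subseteq> J" by auto
  then show ?case
    unfolding blue_Suc next_blue_restrict[OF \<open>{k} \<times> UNIV \<subseteq> J\<close>] using Suc.IH by metis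
qed simp

lemma blue_mono: "k \<le> l \<Longrightarrow> blue G Z \<omega> k \<subseteq> blue G Z \<omega> l"
  by (rule lift_Suc_mono_le) (auto simp del: blue.simps(2) simp: blue_Suc next_blue_def)

context fin_digraph
begin

lemma next_blue_subset: "S \<subseteq> verts G \<Longrightarrow> next_blue G k S \<omega> \<subseteq> verts G"
  using adj_in_verts by (auto simp: next_blue_def)

lemma blue_subset: "Z \<subseteq> verts G \<Longrightarrow> blue G Z \<omega> k \<subseteq> verts G"
  by (induction k) (auto simp del: blue.simps(2) simp: blue_Suc dest: subsetD[OF next_blue_subset])

text \<open>The target is finite, so singletons suffice, and each preimage is a finite Boolean
  combination of conditions on single coordinates. \<open>J\<close> is general because both the
  block of one round and all of \<open>UNIV\<close> occur later.\<close>

lemma measurable_next_blue: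
  assumes S: "S \<subseteq> verts G" and J: "{k} \<times> UNIV \<subseteq> J"
  shows "next_blue G k S \<in> Pi\<^sub>M J (\<lambda>_. borel) \<rightarrow>\<^sub>M count_space (Pow (verts G))"
proof -
  let ?M = "Pi\<^sub>M J (\<lambda>_. borel) :: (nat \<times> 'a \<times> 'a \<Rightarrow> real) measure"
  have [simp]: "finite S" using S by (rule finite_subset) simp
  have coord: "(k, u, w) \<in> J" for u w using J by auto
  have "next_blue G k S -` {T} \<inter> space ?M \<in> sets ?M" if "T \<subseteq> verts G" for T
  proof -
    have "next_blue G k S -` {T} \<inter> space ?M = {\<omega> \<in> space ?M. next_blue G k S \<omega> = T}"
      by auto
    also have "\<dots> = {\<omega> \<in> space ?M. \<forall>w\<in>verts G. w \<in> T \<longleftrightarrow>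
        w \<in> S \<or> (\<exists>u\<in>S. u \<rightarrow> w \<and> \<omega> (k, u, w) \<le> fire_prob G S u)}"
      (is "_ = {\<omega> \<in> _. ?P \<omega>}")
    proof (intro Collect_cong conj_cong refl)
      fix \<omega>
      have "next_blue G k S \<omega> = T \<longleftrightarrow> (\<forall>w\<in>verts G. w \<in> T \<longleftrightarrow> w \<in> next_blue G k S \<omega>)"
        using next_blue_subset[OF S, of k \<omega>] that by blast
      then show "next_blue G k S \<omega> = T \<longleftrightarrow> ?P \<omega>"
        by (auto simp: next_blue_def)
    qed
    also have "\<dots> \<in> sets ?M"
      using coord by measurable
    finally show ?thesis .
  qed
  moreover have "next_blue G k S \<in> space ?M \<rightarrow> Pow (verts G)"
    using next_blue_subset[OF S] by blast
  ultimately show ?thesis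
    by (subst measurable_count_space_eq2) simp_all
qed

lemma measurable_blue:
  assumes Z: "Z \<subseteq> verts G" and J: "{..<k} \<times> UNIV \<subseteq> J"
  shows "(\<lambda>\<omega>. blue G Z \<omega> k) \<in> Pi\<^sub>M J (\<lambda>_. borel) \<rightarrow>\<^sub>M count_space (Pow (verts G))"
  using J
proof (induction k)
  case 0
  then show ?case using Z by simp
next
  case (Suc k)
  then have J: "{..<k} \<times> UNIV \<subseteq> J" "{k} \<times> UNIV \<subseteq> J" by auto
  show ?case
    unfolding blue_Suc
  proof (rule measurable_compose_countable'[where g="\<lambda>\<omega>. blue G Z \<omega> k" and I="Pow (verts G)"])
    fix S assume "S \<in> Pow (verts G)"
    then show "(\<lambda>\<omega>. next_blue G k S \<omega>) \<in> Pi\<^sub>M J (\<lambda>_. borel) \<rightarrow>\<^sub>M count_space (Pow (verts G))"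
      using measurable_next_blue J(2) by simp
  qed (simp_all add: Suc.IH[OF J(1)] countable_finite)
qed

lemma measurable_blue_fire [measurable]:
  "Z \<subseteq> verts G \<Longrightarrow> (\<lambda>\<omega>. blue G Z \<omega> k) \<in> fire_space \<rightarrow>\<^sub>M count_space (Pow (verts G))"
  by (simp add: measurable_cong_sets[OF sets_fire_space refl] measurable_blue)

lemma measurable_next_blue_fire [measurable]:
  "S \<subseteq> verts G \<Longrightarrow> next_blue G k S \<in> fire_space \<rightarrow>\<^sub>M count_space (Pow (verts G))"
  by (simp add: measurable_cong_sets[OF sets_fire_space refl] measurable_next_blue)

text \<open>There are only finitely many vertex sets, so \<open>f\<close> is bounded, crudely by the
  sum of all its absolute values.\<close>

lemma integrable_fire_finite:
  fixes f :: "'a set \<Rightarrow> real"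
  assumes "X \<in> fire_space \<rightarrow>\<^sub>M count_space (Pow (verts G))"
  shows "integrable fire_space (\<lambda>\<omega>. f (X \<omega>))"
proof (rule fire.integrable_const_bound)
  show "AE \<omega> in fire_space. norm (f (X \<omega>)) \<le> (\<Sum>S\<in>Pow (verts G). \<bar>f S\<bar>)"
  proof (rule AE_I2)
    fix \<omega>
    have "X \<omega> \<in> Pow (verts G)"
      using measurable_space[OF assms, of \<omega>] by simp
    then show "norm (f (X \<omega>)) \<le> (\<Sum>S\<in>Pow (verts G). \<bar>f S\<bar>)"
      unfolding real_norm_def by (intro member_le_sum) auto
  qed
  show "(\<lambda>\<omega>. f (X \<omega>)) \<in> borel_measurable fire_space"
    using assms by (rule measurable_compose) simp
qed

lemma indep_blue_next_blue:
  assumes Z: "Z \<subseteq> verts G" and S: "S \<subseteq> verts G"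
  shows "fire.indep_var (count_space (Pow (verts G))) (\<lambda>\<omega>. blue G Z \<omega> k)
           (count_space (Pow (verts G))) (next_blue G k S)"
proof -
  let ?A = "{..<k} \<times> (UNIV :: ('a \<times> 'a) set)" and ?B = "{k} \<times> (UNIV :: ('a \<times> 'a) set)"
  have "fire.indep_var (Pi\<^sub>M ?A (\<lambda>_. borel)) (\<lambda>\<omega>. restrict \<omega> ?A)
          (Pi\<^sub>M ?B (\<lambda>_. borel)) (\<lambda>\<omega>. restrict \<omega> ?B)"
    using fire.indep_var_restrict[OF indep_vars_fire, of ?A ?B] by auto
  from fire.indep_var_compose[OF this measurable_blue[OF Z order.refl] measurable_next_blue[OF S order.refl]]
  show ?thesis
    by (simp add: comp_def blue_restrict next_blue_restrict)
qed

section \<open>Conditioning on the current blue set, drift, and the tail-sum formula\<close>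

text \<open>The law of total expectation over the current blue set \<open>S\<close>. On the event
  that it equals \<open>S\<close>, the next set is \<open>next_blue G k S\<close>, which is
  independent of this event, so each expectation factors.\<close>

lemma expectation_blue_Suc:
  fixes f :: "'a set \<Rightarrow> real"
  assumes Z: "Z \<subseteq> verts G"
  shows "fire.expectation (\<lambda>\<omega>. f (blue G Z \<omega> (Suc k))) =
    (\<Sum>S\<in>Pow (verts G). fire.expectation (\<lambda>\<omega>. indicator {S} (blue G Z \<omega> k)) *
       fire.expectation (\<lambda>\<omega>. f (next_blue G k S \<omega>)))"
proof -
  let ?i = "\<lambda>S \<omega>. indicator {S} (blue G Z \<omega> k) :: real"
  have indep: "fire.indep_var borel (?i S) borel (\<lambda>\<omega>. f (next_blue G k S \<omega>))"
    if "S \<subseteq> verts G" for S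
    using fire.indep_var_compose[OF indep_blue_next_blue[OF Z that],
        of "indicator {S} :: _ \<Rightarrow> real" borel f borel]
    by (simp add: comp_def)
  have int: "integrable fire_space (?i S)" "integrable fire_space (\<lambda>\<omega>. f (next_blue G k S \<omega>))"
    if "S \<subseteq> verts G" for S
    using that Z by (auto intro!: integrable_fire_finite[where f="indicator {S}"] integrable_fire_finite
       measurable_blue_fire measurable_next_blue_fire)
  have "f (blue G Z \<omega> (Suc k)) = (\<Sum>S\<in>Pow (verts G). ?i S \<omega> * f (next_blue G k S \<omega>))" for \<omega>
  proof -
    have "(\<Sum>S\<in>Pow (verts G). ?i S \<omega> * f (next_blue G k S \<omega>)) =
       (\<Sum>S\<in>{blue G Z \<omega> k}. ?i S \<omega> * f (next_blue G k S \<omega>))"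
      using blue_subset[OF Z] by (intro sum.mono_neutral_right) (auto simp: indicator_def)
    then show ?thesis unfolding blue_Suc by simp
  qed
  then have "fire.expectation (\<lambda>\<omega>. f (blue G Z \<omega> (Suc k))) =
     (\<Sum>S\<in>Pow (verts G). fire.expectation (\<lambda>\<omega>. ?i S \<omega> * f (next_blue G k S \<omega>)))"
    by (simp only:) (intro Bochner_Integration.integral_sum fire.indep_var_integrable indep int; auto)
  also have "\<dots> = (\<Sum>S\<in>Pow (verts G). fire.expectation (?i S) *
       fire.expectation (\<lambda>\<omega>. f (next_blue G k S \<omega>)))"
    by (intro sum.cong refl fire.indep_var_lebesgue_integral indep int) auto
  finally show ?thesis .
qed

lemma expectation_blue:
  fixes f :: "'a set \<Rightarrow> real"
  assumes Z: "Z \<subseteq> verts G"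
  shows "fire.expectation (\<lambda>\<omega>. f (blue G Z \<omega> k)) =
    (\<Sum>S\<in>Pow (verts G). fire.expectation (\<lambda>\<omega>. indicator {S} (blue G Z \<omega> k)) * f S)"
proof -
  have "f (blue G Z \<omega> k) = (\<Sum>S\<in>Pow (verts G). indicator {S} (blue G Z \<omega> k) * f S)" for \<omega>
  proof -
    have "(\<Sum>S\<in>Pow (verts G). indicator {S} (blue G Z \<omega> k) * f S) =
       (\<Sum>S\<in>{blue G Z \<omega> k}. indicator {S} (blue G Z \<omega> k) * f S)"
      using blue_subset[OF Z] by (intro sum.mono_neutral_right) (auto simp: indicator_def)
    then show ?thesis by simp
  qed
  then have "fire.expectation (\<lambda>\<omega>. f (blue G Z \<omega> k)) =
     (\<Sum>S\<in>Pow (verts G). fire.expectation (\<lambda>\<omega>. indicator {S} (blue G Z \<omega> k) * f S))"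
    by (simp only:) (intro Bochner_Integration.integral_sum integrable_mult_left
        integrable_fire_finite[OF measurable_blue_fire[OF Z]])
  then show ?thesis by simp
qed

text \<open>The tail P(T > k) of the propagation time T.\<close>

definition unfinished :: "'a set \<Rightarrow> nat \<Rightarrow> real" where
  "unfinished Z k = fire.prob {\<omega>. blue G Z \<omega> k \<noteq> verts G}"

lemma unfinished_sets: "Z \<subseteq> verts G \<Longrightarrow> {\<omega>. blue G Z \<omega> k \<noteq> verts G} \<in> sets fire_space"
  using measurable_sets[OF measurable_blue_fire[of Z k], of "Pow (verts G) - {verts G}"] blue_subset[of Z]
  by (auto simp: vimage_def)

text \<open>A supermartingale-type argument. The full set is a fixed point of the process, so
  \<open>c\<close>, which may have either sign, is charged for a round only while a vertex is
  white.\<close>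

lemma expectation_drift:
  fixes f :: "'a set \<Rightarrow> real"
  assumes Z: "Z \<subseteq> verts G"
    and drift: "\<And>k S. Z \<subseteq> S \<Longrightarrow> S \<subset> verts G \<Longrightarrow>
       fire.expectation (\<lambda>\<omega>. f (next_blue G k S \<omega>)) \<le> f S + c"
  shows "fire.expectation (\<lambda>\<omega>. f (blue G Z \<omega> N)) \<le> f Z + c * (\<Sum>k<N. unfinished Z k)"
proof (induction N)
  case 0
  then show ?case by (simp add: fire.prob_space)
next
  case (Suc N)
  let ?g = "\<lambda>S. f S + c * indicator (- {verts G}) S"
  let ?p = "\<lambda>S. fire.expectation (\<lambda>\<omega>. indicator {S} (blue G Z \<omega> N) :: real)"
  have "fire.expectation (\<lambda>\<omega>. f (blue G Z \<omega> (Suc N))) =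
    (\<Sum>S\<in>Pow (verts G). ?p S * fire.expectation (\<lambda>\<omega>. f (next_blue G N S \<omega>)))"
    by (rule expectation_blue_Suc[OF Z])
  also have "\<dots> \<le> (\<Sum>S\<in>Pow (verts G). ?p S * ?g S)"
  proof (intro sum_mono)
    fix S assume S: "S \<in> Pow (verts G)"
    \<comment> \<open>Sets not containing \<open>Z\<close> have probability 0, proper supersets of
      \<open>Z\<close> obey the drift hypothesis, and the full set does not change.\<close>
    consider "\<not> Z \<subseteq> S" | "Z \<subseteq> S" "S \<subset> verts G" | "S = verts G" using S by auto
    then show "?p S * fire.expectation (\<lambda>\<omega>. f (next_blue G N S \<omega>)) \<le> ?p S * ?g S"
    proof cases
      case 1
      then have "indicator {S} (blue G Z \<omega> N) = (0::real)" for \<omega>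
        using blue_mono[of 0 N G Z \<omega>] by (auto simp: indicator_def)
      then show ?thesis by simp
    next
      case 2
      then show ?thesis using drift[of S N] by (intro mult_left_mono) auto
    next
      case 3
      then have "next_blue G N S \<omega> = S" for \<omega>
        using next_blue_subset[of S N \<omega>] subset_next_blue[of S G N \<omega>] by auto
      then show ?thesis using 3 by (simp add: fire.prob_space)
    qed
  qed
  also have "\<dots> = fire.expectation (\<lambda>\<omega>. ?g (blue G Z \<omega> N))"
    by (rule expectation_blue[OF Z, symmetric])
  also have "\<dots> = fire.expectation (\<lambda>\<omega>. f (blue G Z \<omega> N)) + c * unfinished Z N"
  proof -
    have "(\<lambda>\<omega>. indicator (- {verts G}) (blue G Z \<omega> N)) =
        (indicator {\<omega>. blue G Z \<omega> N \<noteq> verts G} :: _ \<Rightarrow> real)"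
      by (auto simp: indicator_def)
    then have "fire.expectation (\<lambda>\<omega>. indicator (- {verts G}) (blue G Z \<omega> N)) = unfinished Z N"
      by (simp add: unfinished_def)
    then show ?thesis
      by (simp add: integrable_fire_finite[OF measurable_blue_fire[OF Z]])
  qed
  also have "\<dots> \<le> f Z + c * (\<Sum>k<Suc N. unfinished Z k)"
    using Suc by (simp add: algebra_simps)
  finally show ?case .
qed

lemma ennreal_pt_pzf:
  assumes Z: "Z \<subseteq> verts G"
  shows "ennreal_of_enat (pt_pzf G Z \<omega>) = (\<Sum>k. indicator {\<omega>. blue G Z \<omega> k \<noteq> verts G} \<omega>)"
proof (cases "\<exists>k. blue G Z \<omega> k = verts G")
  case True
  define T where "T = (LEAST k. blue G Z \<omega> k = verts G)"
  have T: "blue G Z \<omega> T = verts G" unfolding T_def using True by (rule LeastI_ex)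
  \<comment> \<open>Leastness excludes a full set before \<open>T\<close>; monotonicity keeps the
    set full from \<open>T\<close> on. So the series counts exactly the rounds below
    \<open>T\<close>.\<close>
  have "blue G Z \<omega> k \<noteq> verts G \<longleftrightarrow> k < T" for k
    using not_less_Least[of k "\<lambda>k. blue G Z \<omega> k = verts G"] blue_mono[of T k G Z \<omega>] T
      blue_subset[OF Z, of \<omega> k] by (fastforce simp: T_def not_less)
  then have "(\<Sum>k. indicator {\<omega>. blue G Z \<omega> k \<noteq> verts G} \<omega>) = (\<Sum>k<T. 1 :: ennreal)"
    by (subst suminf_finite[of "{..<T}"]) auto
  then show ?thesis using True by (simp add: pt_pzf_def T_def)
next
  case False
  have "(\<Sum>k. 1 :: ennreal) = \<infinity>"
    by (simp add: suminf_eq_SUP ennreal_SUP_of_nat_eq_top)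
  then show ?thesis using False by (simp add: pt_pzf_def)
qed

text \<open>The tail-sum formula for E T. In \<open>ennreal\<close> it also covers a divergent
  series.\<close>

lemma ept_from_eq_suminf:
  assumes Z: "Z \<subseteq> verts G"
  shows "ept_from G Z = (\<Sum>k. ennreal (unfinished Z k))"
proof -
  have "ept_from G Z = (\<Sum>k. \<integral>\<^sup>+\<omega>. indicator {\<omega>. blue G Z \<omega> k \<noteq> verts G} \<omega> \<partial>fire_space)"
    unfolding ept_from_def ennreal_pt_pzf[OF Z]
    by (intro nn_integral_suminf borel_measurable_indicator unfinished_sets Z)
  then show ?thesis
    by (simp add: unfinished_sets[OF Z] unfinished_def fire.emeasure_eq_measure)
qed

end

section \<open>First and second moments of the number of successful fires\<close>

lemma expectation_of_bool_fire_le: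
  assumes "finite J" "0 \<le> q" "q \<le> 1"
  shows "fire.expectation (\<lambda>\<omega>. of_bool (\<forall>i\<in>J. \<omega> i \<le> q)) = q ^ card J"
proof -
  have "(\<lambda>\<omega>. of_bool (\<forall>i\<in>J. \<omega> i \<le> q)) = (indicator {\<omega>. \<forall>i\<in>J. \<omega> i \<le> q} :: _ \<Rightarrow> real)"
    by (auto simp: indicator_def)
  then show ?thesis
    using prob_fire_le[of J "\<lambda>_. q"] assms by simp
qed

lemma integrable_of_bool_fire_le:
  assumes "finite J"
  shows "integrable fire_space (\<lambda>\<omega>. of_bool (\<forall>i\<in>J. \<omega> i \<le> q) :: real)"
proof (rule fire.integrable_const_bound[where B=1])
  have "{\<omega> \<in> space fire_space. \<forall>i\<in>J. \<omega> i \<le> q} \<in> sets fire_space"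
    using assms by measurable
  then show "(\<lambda>\<omega>. of_bool (\<forall>i\<in>J. \<omega> i \<le> q) :: real) \<in> borel_measurable fire_space"
    unfolding of_bool_def by (intro measurable_If) auto
qed auto

text \<open>For a finite \<open>D\<close> and \<open>q\<close> between 0 and 1, this is a binomial
  variable under \<open>fire_space\<close>, written as a sum of indicators so that linearity of
  expectation applies.\<close>

definition hits :: "'i set \<Rightarrow> real \<Rightarrow> ('i \<Rightarrow> real) \<Rightarrow> real" where
  "hits D q \<omega> = (\<Sum>i\<in>D. of_bool (\<omega> i \<le> q))"

lemma integrable_hits: "integrable fire_space (hits D q)"
  unfolding hits_def
  using integrable_of_bool_fire_le[of "{i}" q for i] by (intro Bochner_Integration.integrable_sum) simp

lemma expectation_hits:
  fixes D :: "(nat \<times> 'a \<times> 'a) set" and q :: real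
  assumes "0 \<le> q" "q \<le> 1"
  shows "fire.expectation (hits D q) = card D * q"
proof -
  have "fire.expectation (hits D q) = (\<Sum>i\<in>D. fire.expectation (\<lambda>\<omega>. of_bool (\<omega> i \<le> q)))"
    unfolding hits_def[abs_def] using integrable_of_bool_fire_le[of "{i}" q for i :: "nat \<times> 'a \<times> 'a"]
    by (intro Bochner_Integration.integral_sum) simp
  then show ?thesis
    using expectation_of_bool_fire_le[of "{i}" q for i :: "nat \<times> 'a \<times> 'a"] assms by simp
qed

text \<open>Writing a product of two indicators as one event over \<open>{i,j}\<close> treats
  diagonal and off-diagonal terms alike: both have expectation
  \<open>q ^ card {i, j}\<close>.\<close>

lemma hits_square: "hits D q \<omega> ^ 2 = (\<Sum>i\<in>D. \<Sum>j\<in>D. of_bool (\<forall>l\<in>{i,j}. \<omega> l \<le> q))"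
  unfolding hits_def power2_eq_square sum_product by (intro sum.cong refl) auto

lemma integrable_hits_square: "integrable fire_space (\<lambda>\<omega>. hits D q \<omega> ^ 2)"
  unfolding hits_square
  by (intro Bochner_Integration.integrable_sum integrable_of_bool_fire_le) simp

lemma expectation_hits_square:
  fixes q :: real
  assumes D: "finite D" and q: "0 \<le> q" "q \<le> 1"
  shows "fire.expectation (\<lambda>\<omega>. hits D q \<omega> ^ 2) = card D * q + card D * (real (card D) - 1) * q\<^sup>2"
proof -
  have "fire.expectation (\<lambda>\<omega>. hits D q \<omega> ^ 2) = (\<Sum>i\<in>D. \<Sum>j\<in>D. q ^ card {i, j})"
  proof -
    have "fire.expectation (\<lambda>\<omega>. hits D q \<omega> ^ 2) =
        (\<Sum>i\<in>D. fire.expectation (\<lambda>\<omega>. \<Sum>j\<in>D. of_bool (\<forall>l\<in>{i,j}. \<omega> l \<le> q)))"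
      unfolding hits_square
      by (intro Bochner_Integration.integral_sum Bochner_Integration.integrable_sum
          integrable_of_bool_fire_le) simp
    also have "\<dots> = (\<Sum>i\<in>D. \<Sum>j\<in>D. fire.expectation (\<lambda>\<omega>. of_bool (\<forall>l\<in>{i,j}. \<omega> l \<le> q)))"
      by (intro sum.cong refl Bochner_Integration.integral_sum integrable_of_bool_fire_le) simp
    also have "\<dots> = (\<Sum>i\<in>D. \<Sum>j\<in>D. q ^ card {i, j})"
      by (intro sum.cong refl expectation_of_bool_fire_le q) simp
    finally show ?thesis .
  qed
  also have "\<dots> = (\<Sum>i\<in>D. q + (real (card D) - 1) * q\<^sup>2)"
  proof (intro sum.cong refl)
    fix i assume "i \<in> D"
    then have "(\<Sum>j\<in>D. q ^ card {i, j}) = q + (\<Sum>j\<in>D - {i}. q ^ card {i, j})"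
      using D by (subst sum.remove) auto
    also have "(\<Sum>j\<in>D - {i}. q ^ card {i, j}) = (\<Sum>j\<in>D - {i}. q\<^sup>2)"
      by (intro sum.cong refl) (auto simp: card_insert_if power2_eq_square)
    finally show "(\<Sum>j\<in>D. q ^ card {i, j}) = q + (real (card D) - 1) * q\<^sup>2"
      using D \<open>i \<in> D\<close> card_gt_0_iff[of D] by (auto simp: of_nat_diff Suc_le_eq)
  qed
  finally show ?thesis by (simp add: algebra_simps)
qed

text \<open>With \<open>x\<close> the relative growth of the blue set, the second moment of \<open>x\<close> can be as large as twice
  its mean. The usual \<open>x - x\<^sup>2 / 2\<close> would then lose everything, hence the smaller coefficients.\<close>

lemma ln_one_plus_ge_quadratic:
  fixes x :: real
  assumes "0 \<le> x"
  shows "3/4 * x - 1/4 * x\<^sup>2 \<le> ln (1 + x)"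
proof -
  let ?f = "\<lambda>x::real. ln (1 + x) - (3/4 * x - 1/4 * x\<^sup>2)"
  have "?f 0 \<le> ?f x"
  proof (rule DERIV_nonneg_imp_nondecreasing[OF assms])
    fix y :: real assume y: "0 \<le> y"
    \<comment> \<open>Completing the square: 1 - (3/4 - y/2)(1 + y) = y^2/2 - y/4 + 1/4 = (y -
      1/4)^2/2 + 7/32, and 7/32 = 1/8 + 3/32.\<close>
    have "1 / (1 + y) - (3/4 - y/2) = (1/8 + 1/2 * (y - 1/4)\<^sup>2 + 3/32) / (1 + y)"
      using y by (simp add: field_simps power2_eq_square)
    then have "0 \<le> 1 / (1 + y) - (3/4 - y/2)" using y by simp
    moreover have "(?f has_real_derivative 1 / (1 + y) - (3/4 - y/2)) (at y)"
      using y by (auto intro!: derivative_eq_intros)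
    ultimately show "\<exists>d. (?f has_real_derivative d) (at y) \<and> 0 \<le> d" by blast
  qed
  then show ?thesis by simp
qed

text \<open>By concavity, \<open>ln\<close> lies below its tangent at \<open>a\<close>.\<close>

lemma ln_diff_le: "0 < a \<Longrightarrow> 0 < b \<Longrightarrow> ln b \<le> ln a + (b - a) / a" for a b :: real
  using ln_le_minus_one[of "b / a"] by (simp add: ln_div diff_divide_distrib)

section \<open>The process on a star\<close>

locale star = graph G for G :: "('a, 'b) pre_digraph" (structure) +
  fixes c :: 'a and L :: "'a set" and n :: nat
  assumes verts_star: "verts G = insert c L" and center: "c \<notin> L" and card_L: "card L = n"
    and arcs_star: "arcs_ends G = {c} \<times> L \<union> L \<times> {c}" and leaves: "1 \<le> n"
begin

lemma card_verts: "card (verts G) = n + 1"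
proof -
  have "finite L" using finite_verts verts_star by simp
  then show ?thesis using center card_L verts_star by simp
qed

text \<open>\<open>out_degree\<close> counts arcs; as there are no parallel ones, the arcs leaving
  \<open>c\<close> correspond to their end pairs, hence to the leaves.\<close>

lemma out_degree_center: "out_degree G c = n"
proof -
  have "inj_on (arc_to_ends G) (out_arcs G c)"
    using no_multi_arcs by (auto intro: inj_onI)
  then have "out_degree G c = card (arc_to_ends G ` out_arcs G c)"
    unfolding out_degree_def by (rule card_image[symmetric])
  also have "arc_to_ends G ` out_arcs G c = {e \<in> arcs_ends G. fst e = c}"
    by (auto simp: arcs_ends_def arc_to_ends_def)
  also have "\<dots> = {c} \<times> L"
    unfolding arcs_star using center by (auto simp: set_eq_iff)
  finally show ?thesis by (simp add: card_cartesian_product card_L)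
qed

lemma fire_prob_center: "S \<subseteq> verts G \<Longrightarrow> fire_prob G S c = card S / n"
proof -
  assume "S \<subseteq> verts G"
  moreover have "closed_nbhd G c = verts G"
    using center by (auto simp: closed_nbhd_def arcs_star verts_star)
  ultimately show ?thesis
    by (simp add: fire_prob_def out_degree_center Int_absorb1)
qed

text \<open>With \<open>c\<close> blue, every white vertex is a leaf, and its only neighbour is
  \<open>c\<close>. So one fire decides its fate.\<close>

lemma next_blue_center:
  assumes "c \<in> S" "S \<subseteq> verts G"
  shows "next_blue G k S \<omega> = S \<union> {w \<in> verts G - S. \<omega> (k, c, w) \<le> card S / n}"
  using assms center unfolding next_blue_def
  by (auto simp: arcs_star verts_star fire_prob_center[OF assms(2)])

lemma next_blue_leaf: "c \<notin> S \<Longrightarrow> next_blue G k S \<omega> \<subseteq> insert c S"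
  unfolding next_blue_def by (auto simp: arcs_star)

lemma card_next_blue:
  assumes "c \<in> S" "S \<subseteq> verts G"
  shows "card (next_blue G k S \<omega>) = card S + hits ((\<lambda>w. (k, c, w)) ` (verts G - S)) (card S / n) \<omega>"
proof -
  have "finite S" using assms(2) by (rule finite_subset) simp
  then have "card (next_blue G k S \<omega>) = card S + card {w \<in> verts G - S. \<omega> (k, c, w) \<le> card S / n}"
    unfolding next_blue_center[OF assms] by (intro card_Un_disjoint) auto
  moreover have "inj_on (\<lambda>w. (k, c, w)) (verts G - S)"
    by (auto intro: inj_onI)
  then have "hits ((\<lambda>w. (k, c, w)) ` (verts G - S)) (card S / n) \<omega> =
      (\<Sum>w\<in>verts G - S. of_bool (\<omega> (k, c, w) \<le> card S / n))"
    unfolding hits_def by (simp add: sum.reindex del: sum_of_bool_eq)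
  ultimately show ?thesis
    by (simp add: sum_of_bool_eq Int_def)
qed

lemma card_white:
  assumes "S \<subseteq> verts G"
  shows "card (verts G - S) = n + 1 - card S"
  using assms card_verts finite_subset[OF assms] by (simp add: card_Diff_subset)

lemma card_le_n:
  assumes "S \<subset> verts G"
  shows "card S \<le> n"
  using psubset_card_mono[OF finite_verts assms] card_verts by simp

lemma card_coordinates:
  assumes "S \<subset> verts G"
  shows "real (card ((\<lambda>w. (k, c, w)) ` (verts G - S))) = real n + 1 - real (card S)"
proof -
  have "card ((\<lambda>w. (k, c, w)) ` (verts G - S)) = card (verts G - S)"
    by (intro card_image inj_onI) simp
  then show ?thesis
    using card_white[of S] card_le_n[OF assms] assms by (simp add: of_nat_diff)
qed

lemma card_subset_pos: "S \<subseteq> verts G \<Longrightarrow> S \<noteq> {} \<Longrightarrow> 0 < card S"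
  using finite_subset[OF _ finite_verts] by (simp add: card_gt_0_iff)

lemma card_next_blue_bounds:
  assumes S: "S \<subseteq> verts G" "S \<noteq> {}"
  shows "1 \<le> card (next_blue G k S \<omega>)" "card (next_blue G k S \<omega>) \<le> n + 1"
proof -
  have "finite (next_blue G k S \<omega>)"
    using next_blue_subset[OF S(1)] by (rule finite_subset) simp
  with subset_next_blue[of S G k \<omega>] S(2) show "1 \<le> card (next_blue G k S \<omega>)"
    by (metis Suc_leI One_nat_def card_gt_0_iff subset_empty)
  show "card (next_blue G k S \<omega>) \<le> n + 1"
    using card_mono[OF finite_verts next_blue_subset[OF S(1)]] card_verts by simp
qed

section \<open>Expected change of the two potentials in one round\<close>

text \<open>With \<open>c\<close> blue, the expected number of new blue vertices is at most the
  current number b, and the tangent of \<open>ln\<close> at b turns this into an increase of at most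
  1. With \<open>c\<close> white, at most one vertex is added.\<close>

lemma expectation_ln_card_next_blue:
  assumes S: "S \<subset> verts G" "S \<noteq> {}"
  shows "fire.expectation (\<lambda>\<omega>. ln (card (next_blue G k S \<omega>))) \<le> ln (card S) + 1"
proof -
  let ?b = "real (card S)"
  have b: "1 \<le> ?b" using card_subset_pos[OF psubset_imp_subset[OF S(1)] S(2)] by simp
  have int: "integrable fire_space (\<lambda>\<omega>. ln (card (next_blue G k S \<omega>)))"
    using S by (intro integrable_fire_finite[where f="\<lambda>S. ln (card S)"] measurable_next_blue_fire) auto
  show ?thesis
  proof (cases "c \<in> S")
    case True
    define D where "D = (\<lambda>w. (k, c, w)) ` (verts G - S)"
    define q where "q = ?b / n"
    have q: "0 \<le> q" "q \<le> 1" using card_le_n[OF S(1)] leaves by (auto simp: q_def divide_simps)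
    have card_eq: "card (next_blue G k S \<omega>) = ?b + hits D q \<omega>" for \<omega>
      unfolding D_def q_def using card_next_blue[OF True] S by auto
    have "fire.expectation (\<lambda>\<omega>. ln (card (next_blue G k S \<omega>))) \<le>
        fire.expectation (\<lambda>\<omega>. ln ?b + hits D q \<omega> / ?b)"
    proof (intro integral_mono int)
      fix \<omega>
      have "0 < real (card (next_blue G k S \<omega>))"
        using card_next_blue_bounds(1)[of S k \<omega>] S by auto
      from ln_diff_le[OF _ this, of ?b] b
      show "ln (card (next_blue G k S \<omega>)) \<le> ln ?b + hits D q \<omega> / ?b"
        by (simp add: card_eq)
    qed (simp add: integrable_hits)
    also have "\<dots> = fire.expectation (\<lambda>\<omega> :: nat \<times> 'a \<times> 'a \<Rightarrow> real. ln ?b) +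
        fire.expectation (\<lambda>\<omega>. hits D q \<omega> / ?b)"
      by (intro Bochner_Integration.integral_add) (simp_all add: integrable_hits)
    also have "\<dots> = ln ?b + card D * q / ?b"
      by (simp add: expectation_hits q)
    \<comment> \<open>The factor b of the success probability b/n cancels; the white fraction that
      remains is at most 1 because b is at least 1.\<close>
    also have "card D * q / ?b = (real n + 1 - ?b) / n"
      using card_coordinates[OF S(1), of k] b by (simp add: D_def q_def)
    also have "\<dots> \<le> 1" using b leaves by simp
    finally show ?thesis by simp
  next
    case False
    have "fire.expectation (\<lambda>\<omega>. ln (card (next_blue G k S \<omega>))) \<le> fire.expectation (\<lambda>\<omega> :: nat \<times> 'a \<times> 'a \<Rightarrow> real. ln ?b + 1)"
    proof (intro integral_mono int)
      fix \<omega>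
      have "finite S" using S(1) by (meson finite_subset finite_verts psubset_imp_subset)
      then have "card (next_blue G k S \<omega>) \<le> card S + 1"
        using card_mono[OF _ next_blue_leaf[OF False], of k \<omega>] False by simp
      then have "ln (card (next_blue G k S \<omega>)) \<le> ln (?b + 1)"
        using card_next_blue_bounds(1)[of S k \<omega>] S by (subst ln_le_cancel_iff) auto
      also have "\<dots> \<le> ln ?b + 1 / ?b"
        using ln_diff_le[of ?b "?b + 1"] b by simp
      also have "\<dots> \<le> ln ?b + 1" using b by simp
      finally show "ln (card (next_blue G k S \<omega>)) \<le> ln ?b + 1" .
    qed simp
    then show ?thesis by simp
  qed
qed

text \<open>The argument n + 2 - b is W + 1, which stays positive when no white leaf is left. The
  tangent bound handles \<open>ln (W + 1)\<close>, the quadratic bound with x =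
  \<open>hits D q \<omega> / b\<close> handles \<open>ln b\<close>, and the moments of
  \<open>hits\<close> do the rest.\<close>

lemma expectation_potential_next_blue:
  assumes S: "S \<subset> verts G" and c: "c \<in> S"
  shows "fire.expectation (\<lambda>\<omega>. ln (real n + 2 - card (next_blue G k S \<omega>)) - ln (card (next_blue G k S \<omega>)))
    \<le> ln (real n + 2 - card S) - ln (card S) + (- 1/4)"
proof -
  define b W where "b = real (card S)" and "W = real n + 1 - b"
  define D where "D = (\<lambda>w. (k, c, w)) ` (verts G - S)"
  define q where "q = b / n"
  have b: "1 \<le> b" using card_subset_pos[OF psubset_imp_subset[OF S]] c by (force simp: b_def Suc_le_eq)
  have W: "1 \<le> W" using card_le_n[OF S] by (simp add: W_def b_def)
  have n: "0 < real n" using leaves by simp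
  have q: "0 \<le> q" "q \<le> 1" using b W n by (auto simp: q_def W_def divide_simps)
  have card_D: "card D = W"
    using card_coordinates[OF S] by (simp add: D_def W_def b_def)
  have fin_D: "finite D" by (simp add: D_def)
  have card_eq: "card (next_blue G k S \<omega>) = b + hits D q \<omega>" for \<omega>
    unfolding D_def q_def b_def using card_next_blue[OF c] S by auto
  have "fire.expectation (\<lambda>\<omega>. ln (real n + 2 - card (next_blue G k S \<omega>)) - ln (card (next_blue G k S \<omega>)))
    \<le> fire.expectation (\<lambda>\<omega>. ln (W + 1) - ln b - hits D q \<omega> / (W + 1) - 3/4 * (hits D q \<omega> / b)
         + 1/4 * ((hits D q \<omega>)\<^sup>2 / b\<^sup>2))"
  proof (intro integral_mono)
    show "integrable fire_space
       (\<lambda>\<omega>. ln (real n + 2 - card (next_blue G k S \<omega>)) - ln (card (next_blue G k S \<omega>)))"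
      using S by (intro integrable_fire_finite[where f="\<lambda>S. ln (real n + 2 - card S) - ln (card S)"]
          measurable_next_blue_fire) auto
    fix \<omega>
    let ?h = "hits D q \<omega>"
    have h: "0 \<le> ?h" by (simp add: hits_def sum_nonneg)
    have "card (next_blue G k S \<omega>) \<le> n + 1"
      using card_next_blue_bounds(2)[of S k \<omega>] S c by blast
    \<comment> \<open>At most W leaves are hit, so W + 1 - h is at least 1 and the tangent bound
      applies.\<close>
    then have "b + ?h \<le> n + 1"
      unfolding card_eq[symmetric] by simp
    then have "ln (W + 1 - ?h) \<le> ln (W + 1) - ?h / (W + 1)"
      using ln_diff_le[of "W + 1" "W + 1 - ?h"] W by (simp add: W_def)
    moreover have "3/4 * (?h / b) - 1/4 * (?h\<^sup>2 / b\<^sup>2) \<le> ln (b + ?h) - ln b"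
    proof -
      have "ln (1 + ?h / b) = ln (b + ?h) - ln b"
        using ln_div[of "b + ?h" b] h b by (simp add: add_divide_distrib)
      then show ?thesis
        using ln_one_plus_ge_quadratic[of "?h / b"] h b by (simp add: power_divide)
    qed
    moreover have W_h: "real n + 2 - (b + ?h) = W + 1 - ?h" by (simp add: W_def)
    ultimately show "ln (real n + 2 - card (next_blue G k S \<omega>)) - ln (card (next_blue G k S \<omega>))
      \<le> ln (W + 1) - ln b - ?h / (W + 1) - 3/4 * (?h / b) + 1/4 * (?h\<^sup>2 / b\<^sup>2)"
      unfolding card_eq W_h by linarith
  qed (simp add: integrable_hits integrable_hits_square)
  also have "\<dots> = ln (W + 1) - ln b - W * q / (W + 1) - 3/4 * (W * q / b)
      + 1/4 * ((W * q + W * (W - 1) * q\<^sup>2) / b\<^sup>2)"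
    by (simp add: integrable_hits integrable_hits_square expectation_hits[OF q]
        expectation_hits_square[OF fin_D q] card_D)
  also have "\<dots> \<le> ln (W + 1) - ln b - 1/4"
  proof -
    \<comment> \<open>W is at least 1, so W / (W + 1) is at least 1/2.\<close>
    have "b / (2 * n) \<le> W * q / (W + 1)"
      using W b n by (simp add: q_def divide_simps)
    moreover have "W * q / b = W / n"
      using b by (simp add: q_def)
    \<comment> \<open>So the quadratic term costs at most W / (2n), leaving W / (4n) of the gain 3W
      / (4n).\<close>
    moreover have "(W * q + W * (W - 1) * q\<^sup>2) / b\<^sup>2 \<le> 2 * (W / n)"
    proof -
      have "(W * q + W * (W - 1) * q\<^sup>2) / b\<^sup>2 = W / n * (1 / b + (W - 1) / n)"
        using b n by (simp add: q_def field_simps power2_eq_square)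
      also have "\<dots> \<le> W / n * (1 + 1)"
        using b W n by (intro mult_left_mono add_mono) (auto simp: W_def divide_simps)
      finally show ?thesis by (simp add: mult.commute)
    qed
    \<comment> \<open>Since b + W = n + 1, the total gain is (2b + W) / (4n) = (n + 1 + b) /
      (4n).\<close>
    moreover have "1/4 \<le> b / (2 * n) + 1/4 * (W / n)"
      using b W n by (simp add: W_def field_simps)
    ultimately show ?thesis by simp
  qed
  also have "\<dots> = ln (real n + 2 - card S) - ln (card S) + (- 1/4)"
  proof -
    have "W + 1 = real n + 2 - card S" by (simp add: W_def b_def)
    show ?thesis unfolding \<open>W + 1 = _\<close> b_def by simp
  qed
  finally show ?thesis .
qed

section \<open>Bounds on the expected propagation time of the star\<close>

lemma blue_card_bounds:
  assumes Z: "Z \<subseteq> verts G" "Z \<noteq> {}"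
  shows "1 \<le> card (blue G Z \<omega> k)" "card (blue G Z \<omega> k) \<le> n + 1"
proof -
  have "finite (blue G Z \<omega> k)"
    using blue_subset[OF Z(1)] by (rule finite_subset) simp
  with blue_mono[of 0 k G Z \<omega>] Z(2) show "1 \<le> card (blue G Z \<omega> k)"
    by (metis Suc_leI One_nat_def blue.simps(1) card_gt_0_iff le0 subset_empty)
  show "card (blue G Z \<omega> k) \<le> n + 1"
    using card_mono[OF finite_verts blue_subset[OF Z(1)]] card_verts by simp
qed

lemma unfinished_nonneg: "0 \<le> unfinished Z k"
  by (simp add: unfinished_def)

lemma ept_from_ge:
  assumes v: "v \<in> verts G"
  shows "ennreal (ln (n + 1)) \<le> ept_from G {v}"
proof -
  let ?a = "unfinished {v}"
  have Z: "{v} \<subseteq> verts G" using v by simp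
  \<comment> \<open>On the event that the process has finished, which has probability 1 -
    \<open>?a N\<close>, the potential equals \<open>ln (n + 1)\<close>; elsewhere it is
    nonnegative. It starts at \<open>ln 1 = 0\<close>.\<close>
  have partial: "ln (n + 1) * (1 - ?a N) \<le> (\<Sum>k<N. ?a k)" for N
  proof -
    have ev: "{\<omega>. blue G {v} \<omega> N \<noteq> verts G} \<in> sets fire_space"
      by (rule unfinished_sets[OF Z])
    then have int: "integrable fire_space (indicator {\<omega>. blue G {v} \<omega> N \<noteq> verts G} :: _ \<Rightarrow> real)"
      by (simp add: fire.emeasure_eq_measure)
    have "ln (n + 1) * (1 - ?a N) =
        fire.expectation (\<lambda>\<omega>. ln (n + 1) * (1 - indicator {\<omega>. blue G {v} \<omega> N \<noteq> verts G} \<omega>))"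
      using ev int by (simp add: unfinished_def)
    also have "\<dots> \<le> fire.expectation (\<lambda>\<omega>. ln (card (blue G {v} \<omega> N)))"
    proof (intro integral_mono)
      show "integrable fire_space (\<lambda>\<omega>. ln (card (blue G {v} \<omega> N)))"
        by (rule integrable_fire_finite[OF measurable_blue_fire[OF Z]])
      fix \<omega>
      show "ln (n + 1) * (1 - indicator {\<omega>. blue G {v} \<omega> N \<noteq> verts G} \<omega>) \<le> ln (card (blue G {v} \<omega> N))"
        using blue_card_bounds(1)[OF Z, of \<omega> N] by (simp add: indicator_def card_verts add.commute)
    qed (use int in simp)
    also have "\<dots> \<le> ln (card {v}) + 1 * (\<Sum>k<N. ?a k)"
      using expectation_ln_card_next_blue
      by (intro expectation_drift[where f="\<lambda>S. ln (card S)"] Z) auto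
    finally show ?thesis by simp
  qed
  show ?thesis
  \<comment> \<open>If the tail sum converges, the tails tend to 0 and the limit gives the bound;
    otherwise the expected time is infinite.\<close>
  proof (cases "summable ?a")
    case True
    have "(\<lambda>N. ln (n + 1) * (1 - ?a N)) \<longlonglongrightarrow> ln (n + 1) * (1 - 0)"
      by (intro tendsto_intros summable_LIMSEQ_zero True)
    moreover have "ln (n + 1) * (1 - ?a N) \<le> suminf ?a" for N
      by (rule order_trans[OF partial sum_le_suminf[OF True]]) (simp_all add: unfinished_nonneg)
    ultimately have "ln (n + 1) * (1 - 0) \<le> suminf ?a"
      by (intro LIMSEQ_le_const2) auto
    then have "ln (n + 1) \<le> suminf ?a" by simp
    then show ?thesis
      unfolding ept_from_eq_suminf[OF Z]
      by (simp add: suminf_ennreal2 True unfinished_nonneg ennreal_leI)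
  next
    case False
    then have "(\<Sum>k. ennreal (?a k)) = top"
      using summable_suminf_not_top[of ?a, OF unfinished_nonneg] by auto
    then show ?thesis
      unfolding ept_from_eq_suminf[OF Z] by simp
  qed
qed

text \<open>The potential starts at \<open>ln (n + 1)\<close> and never falls below
  \<open>- ln (n + 1)\<close>. A total drop of at most \<open>2 * ln (n + 1)\<close> at rate 1/4
  gives the factor 8.\<close>

lemma ept_from_center_le: "ept_from G {c} \<le> ennreal (8 * ln (n + 1))"
proof -
  have Z: "{c} \<subseteq> verts G" using verts_star by simp
  let ?f = "\<lambda>S :: 'a set. ln (real n + 2 - card S) - ln (card S)"
  have "(\<Sum>k<N. unfinished {c} k) \<le> 8 * ln (n + 1)" for N
  proof -
    have "fire.expectation (\<lambda>\<omega> :: nat \<times> 'a \<times> 'a \<Rightarrow> real. - ln (n + 1)) \<le> fire.expectation (\<lambda>\<omega>. ?f (blue G {c} \<omega> N))"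
    proof (intro integral_mono)
      show "integrable fire_space (\<lambda>\<omega>. ?f (blue G {c} \<omega> N))"
        by (rule integrable_fire_finite[OF measurable_blue_fire[OF Z]])
      fix \<omega>
      have "1 \<le> card (blue G {c} \<omega> N)" "card (blue G {c} \<omega> N) \<le> n + 1"
        using blue_card_bounds[OF Z] by auto
      then have "0 \<le> ln (real n + 2 - card (blue G {c} \<omega> N))"
        "ln (card (blue G {c} \<omega> N)) \<le> ln (n + 1)"
        by (auto intro!: ln_ge_zero)
      then show "- ln (n + 1) \<le> ?f (blue G {c} \<omega> N)" by simp
    qed simp
    also have "\<dots> \<le> ?f {c} + (- 1/4) * (\<Sum>k<N. unfinished {c} k)"
      using expectation_potential_next_blue
      by (intro expectation_drift[where f="?f"] Z) auto
    finally show ?thesis by (simp add: add.commute)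
  qed
  then show ?thesis
    unfolding ept_from_eq_suminf[OF Z]
    by (intro suminf_le_const) (auto simp: sum_ennreal unfinished_nonneg intro!: ennreal_leI)
qed

lemma ept_bounds: "ln (n + 1) \<le> enn2real (ept G)" "enn2real (ept G) \<le> 8 * ln (n + 1)"
proof -
  have "verts G \<noteq> {}" using verts_star by simp
  then have "ept G \<in> (\<lambda>v. ept_from G {v}) ` verts G"
    unfolding ept_def by (intro Min_in) auto
  then have lower: "ennreal (ln (n + 1)) \<le> ept G"
    using ept_from_ge by auto
  have "ept G \<le> ept_from G {c}"
    unfolding ept_def by (intro Min_le finite_imageI finite_verts imageI) (simp add: verts_star)
  also note ept_from_center_le
  finally have upper: "ept G \<le> ennreal (8 * ln (n + 1))" .
  show "enn2real (ept G) \<le> 8 * ln (n + 1)"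
    using enn2real_mono[OF upper] by simp
  \<comment> \<open>Finiteness is needed for the lower bound, as \<open>enn2real\<close> sends
    infinity to 0.\<close>
  have "ept G < top" using upper by (rule le_less_trans) simp
  then show "ln (n + 1) \<le> enn2real (ept G)"
    using enn2real_mono[OF lower] by simp
qed

end

theorem theorem2p7:
  fixes G :: "nat \<Rightarrow> ('a, 'b) pre_digraph"
  assumes star: "\<And>n. n \<ge> 1 \<Longrightarrow> K\<^bsub>1,n\<^esub> (G n)"
  shows "(\<lambda>n. enn2real (ept (G n))) \<in> \<Theta>(\<lambda>n. ln (real n))"
proof -
  have bounds: "ln (real n + 1) \<le> enn2real (ept (G n))" "enn2real (ept (G n)) \<le> 8 * ln (real n + 1)"
    if n: "1 \<le> n" for n
  proof -
    obtain U L where "graph (G n)" "verts (G n) = U \<union> L" "U \<inter> L = {}" "card U = 1" "card L = n"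
      "arcs_ends (G n) = U \<times> L \<union> L \<times> U"
      using star[OF n] unfolding complete_bipartite_digraph_def by blast
    moreover from this obtain c where "U = {c}" by (auto simp: card_1_singleton_iff)
    ultimately interpret star "G n" c L n
      using n by (intro star.intro star_axioms.intro) auto
    show "ln (real n + 1) \<le> enn2real (ept (G n))" "enn2real (ept (G n)) \<le> 8 * ln (real n + 1)"
      using ept_bounds by (auto simp: add.commute)
  qed
  \<comment> \<open>Trades \<open>ln (n + 1)\<close> for \<open>ln n\<close> through n + 1 <= 2n <=
    n^2; the factor 2 makes the final upper constant 8 * 2 = 16. At n = 1 this fails, since
    \<open>ln 1 = 0\<close>.\<close>
  have log: "ln (real n + 1) \<le> 2 * ln (real n)" if "2 \<le> n" for n :: nat
  proof -
    have "n + 1 \<le> n ^ 2" using that by (auto simp: power2_eq_square intro: order_trans[of _ "2 * n"])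
    then have "real n + 1 \<le> real n ^ 2" by (metis of_nat_1 of_nat_add of_nat_le_iff of_nat_power)
    then have "ln (real n + 1) \<le> ln (real n ^ 2)" using that by (subst ln_le_cancel_iff) auto
    then show ?thesis using that by (simp add: ln_realpow)
  qed
  show ?thesis
  proof (rule bigthetaI')
    show "\<forall>\<^sub>F n in at_top. 1 * norm (ln (real n)) \<le> norm (enn2real (ept (G n))) \<and>
        norm (enn2real (ept (G n))) \<le> 16 * norm (ln (real n))"
      using eventually_ge_at_top[of 2]
    proof eventually_elim
      case (elim n)
      have "ln (real n) \<le> ln (real n + 1)" using elim by simp
      moreover have "0 \<le> ln (real n)" using elim by simp
      moreover note bounds[of n] log[of n] elim
      ultimately show ?case
        unfolding real_norm_def by (intro conjI; linarith)
    qed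
  qed auto
qed

end
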